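(* The Shannon capacity $C$ of any channel that dies $(\mathcal{X},p_a(y|x),p_d(y|x),p_T(t),\mathcal{Y})$ is zero.
   Context: Channel that dies: finite input alphabet $\mathcal{X}$, finite output alphabet $\mathcal{Y}$ containing an erasure symbol $?$. There are two states, alive ($a$) and dead ($d$). In state $a$ the channel acts as a noisy discrete memoryless channel $p_a(y|x)$ that never outputs $?$; in state $d$ it outputs $?$ with probability 1 whatever the input. The state is $a$ at times $n=1,\dots,T$ and $d$ at times $n=T+1,T+2,\dots$, where $T$ is a random positive integer with distribution $p_T$, independent of the inputs and of the channel noise. The initial state is $a$. Shannon capacity: the supremum of rates $R\ge 0$ for which there exist block codes of length $n\to\infty$ with at least $2^{nR}$ messages, used over channel times $1,\dots,n$, whose probability of decoding error tends to $0$. *)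

theory Defs
  imports "HOL-Probability.Probability"
begin

datatype state = Alive | Dead

definition state_at :: "nat \<Rightarrow> nat \<Rightarrow> state" where
  "state_at t n = (if n \<le> t then Alive else Dead)"

primrec letter_channel ::
  "('x \<Rightarrow> 'y pmf) \<Rightarrow> ('x \<Rightarrow> 'y pmf) \<Rightarrow> state \<Rightarrow> 'x \<Rightarrow> 'y pmf" where
  "letter_channel p_a p_d Alive = p_a"
| "letter_channel p_a p_d Dead = p_d"

text \<open>The alphabets are finite types. The pmf on the naturals makes the time of death
  almost surely finite; excluding 0 from its support makes the initial state alive.\<close>

definition channel_that_dies ::
  "('x::finite \<Rightarrow> 'y::finite pmf) \<Rightarrow> ('x \<Rightarrow> 'y pmf) \<Rightarrow> nat pmf \<Rightarrow> 'y \<Rightarrow> bool" where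
  "channel_that_dies p_a p_d p_T erasure \<longleftrightarrow>
     (\<forall>x. pmf (p_a x) erasure = 0) \<and>
     (\<forall>x. p_d x = return_pmf erasure) \<and>
     pmf p_T 0 = 0"

text \<open>Output word when the time of death is \<open>t\<close> and the letters of the input word are sent
  at times \<open>n, n + 1, \<dots>\<close>.\<close>

primrec outputs_given ::
  "('x \<Rightarrow> 'y pmf) \<Rightarrow> ('x \<Rightarrow> 'y pmf) \<Rightarrow> nat \<Rightarrow> nat \<Rightarrow> 'x list \<Rightarrow> 'y list pmf" where
  "outputs_given p_a p_d t n [] = return_pmf []"
| "outputs_given p_a p_d t n (x # xs) =
     bind_pmf (letter_channel p_a p_d (state_at t n) x) (\<lambda>y.
     bind_pmf (outputs_given p_a p_d t (Suc n) xs) (\<lambda>ys.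
     return_pmf (y # ys)))"

text \<open>The time of death is drawn from \<open>p_T\<close> whatever the input word: it is independent of
  the inputs and of the noise, and known neither to the encoder nor to the decoder.\<close>

definition dying_block_channel ::
  "('x \<Rightarrow> 'y pmf) \<Rightarrow> ('x \<Rightarrow> 'y pmf) \<Rightarrow> nat pmf \<Rightarrow> 'x list \<Rightarrow> 'y list pmf" where
  "dying_block_channel p_a p_d p_T xs = bind_pmf p_T (\<lambda>t. outputs_given p_a p_d t 1 xs)"

text \<open>A block code of length \<open>n\<close> for the messages \<open>0, \<dots>, M - 1\<close>.\<close>

definition block_code ::
  "nat \<Rightarrow> nat \<Rightarrow> (nat \<Rightarrow> 'x list) \<Rightarrow> ('y list \<Rightarrow> nat) \<Rightarrow> bool" where
  "block_code n M enc dec \<longleftrightarrow>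
     M > 0 \<and> (\<forall>m<M. length (enc m) = n) \<and> (\<forall>ys. length ys = n \<longrightarrow> dec ys < M)"

text \<open>Probability of decoding error for a uniformly distributed message.\<close>

definition error_prob ::
  "('x list \<Rightarrow> 'y list pmf) \<Rightarrow> nat \<Rightarrow> (nat \<Rightarrow> 'x list) \<Rightarrow> ('y list \<Rightarrow> nat) \<Rightarrow> real" where
  "error_prob W M enc dec =
     (\<Sum>m<M. measure_pmf.prob (W (enc m)) {ys. dec ys \<noteq> m}) / real M"

definition achievable_rate :: "('x list \<Rightarrow> 'y list pmf) \<Rightarrow> real \<Rightarrow> bool" where
  "achievable_rate W R \<longleftrightarrow>
     (\<exists>M enc dec.
        (\<forall>n. block_code n (M n) (enc n) (dec n) \<and> real (M n) \<ge> 2 powr (real n * R)) \<and>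
        (\<lambda>n. error_prob W (M n) (enc n) (dec n)) \<longlonglongrightarrow> 0)"

text \<open>The supremum is taken in the extended reals, where it is a genuine supremum even for an
  empty or an unbounded set of rates.\<close>

definition shannon_capacity :: "('x list \<Rightarrow> 'y list pmf) \<Rightarrow> ereal" where
  "shannon_capacity W = Sup (ereal ` {R. R \<ge> 0 \<and> achievable_rate W R})"

end

theory Submission
  imports Defs "HOL-Real_Asymp.Real_Asymp"
begin

text \<open>Condition on a time of death \<open>t\<close> of positive probability. The output word is then one of
  boundedly many, uniformly in the block length: at most \<open>t\<close> letters followed by erasures.
  A decoder that sees at most \<open>K\<close> different words recovers at most \<open>K\<close> of the \<open>M\<close> messages, so the
  error probability is at least \<open>p_T(t) (1 - K / M)\<close>, which stays away from \<open>0\<close> when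
  \<open>M\<close> tends to infinity, as it does at every positive rate.\<close>

text \<open>In the average over \<open>p\<close>, only the contribution of the single value
  \<open>t\<close> is kept.\<close>

lemma prob_bind_pmf_ge:
  "pmf p t * measure_pmf.prob (f t) A \<le> measure_pmf.prob (bind_pmf p f) A"
proof -
  have "ennreal (pmf p t * measure_pmf.prob (f t) A)
      = (\<integral>\<^sup>+ x. emeasure (f t) A * indicator {t} x \<partial>p)"
    by (subst nn_integral_cmult_indicator)
      (simp_all add: pmf.rep_eq ennreal_mult measure_pmf.emeasure_eq_measure mult.commute)
  also have "\<dots> \<le> (\<integral>\<^sup>+ x. emeasure (f x) A \<partial>p)"
    by (intro nn_integral_mono) (auto simp: indicator_def)
  also have "\<dots> = ennreal (measure_pmf.prob (bind_pmf p f) A)"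
    by (simp only: emeasure_bind_pmf measure_pmf.emeasure_eq_measure[symmetric])
  finally show ?thesis
    by simp
qed

text \<open>Message \<open>m\<close> is decoded with probability 0 unless some word of
  \<open>S\<close> decodes to \<open>m\<close>, and with probability at most 1 otherwise. The words
  decoding to different messages form disjoint subsets of \<open>S\<close>.\<close>

lemma sum_prob_decode_le_card:
  fixes q :: "nat \<Rightarrow> 'a pmf"
  assumes "finite S" and supp: "\<And>m. m < M \<Longrightarrow> set_pmf (q m) \<subseteq> S"
  shows "(\<Sum>m<M. measure_pmf.prob (q m) {y. dec y = m}) \<le> real (card S)"
proof -
  have "(\<Sum>m<M. measure_pmf.prob (q m) {y. dec y = m}) \<le> (\<Sum>m<M. real (card {y \<in> S. dec y = m}))"
  proof (rule sum_mono)
    fix m assume "m \<in> {..<M}"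
    then have "set_pmf (q m) \<subseteq> S"
      using supp by simp
    show "measure_pmf.prob (q m) {y. dec y = m} \<le> real (card {y \<in> S. dec y = m})"
    proof (cases "{y \<in> S. dec y = m} = {}")
      case True
      with \<open>set_pmf (q m) \<subseteq> S\<close> show ?thesis
        by (subst measure_pmf_zero_iff[THEN iffD2]) auto
    next
      case False
      with \<open>finite S\<close> have "1 \<le> card {y \<in> S. dec y = m}"
        by (simp add: Suc_le_eq card_gt_0_iff)
      then show ?thesis
        by (intro order.trans[OF measure_pmf.prob_le_1]) simp
    qed
  qed
  also have "\<dots> = real (card (\<Union>m<M. {y \<in> S. dec y = m}))"
    using \<open>finite S\<close> by (subst card_UN_disjoint) auto
  also have "\<dots> \<le> real (card S)"
    using \<open>finite S\<close> by (intro of_nat_mono card_mono) auto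
  finally show ?thesis .
qed

text \<open>\<open>Suc t - n\<close> counts the times from \<open>n\<close> to \<open>t\<close> at
  which the channel is still alive, truncated to 0 after death. The set of prefixes
  \<open>us\<close> does not depend on \<open>xs\<close>, so its size bounds the number of outputs
  for every block length.\<close>

lemma set_pmf_outputs_given:
  assumes "\<And>x. p_d x = return_pmf e"
  shows "set_pmf (outputs_given p_a p_d t n xs)
    \<subseteq> (\<lambda>us. us @ replicate (length xs - length us) e) ` {us. length us \<le> Suc t - n}"
proof (induction xs arbitrary: n)
  case Nil
  show ?case by (auto intro!: image_eqI[where x = "[]"])
next
  case (Cons x xs)
  show ?case
  proof
    fix zs assume "zs \<in> set_pmf (outputs_given p_a p_d t n (x # xs))"
    then obtain y ys where y: "y \<in> set_pmf (letter_channel p_a p_d (state_at t n) x)"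
      and ys: "ys \<in> set_pmf (outputs_given p_a p_d t (Suc n) xs)" and zs: "zs = y # ys"
      by auto
    from ys Cons.IH obtain us where us: "length us \<le> Suc t - Suc n"
      "ys = us @ replicate (length xs - length us) e"
      by blast
    show "zs \<in> (\<lambda>us. us @ replicate (length (x # xs) - length us) e) ` {us. length us \<le> Suc t - n}"
    proof (cases "n \<le> t")
      case True
      then show ?thesis
        using us zs by (intro image_eqI[where x = "y # us"]) auto
    next
      \<comment> \<open>The channel is already dead: the bound on \<open>us\<close> from the
        induction hypothesis is 0, so \<open>ys\<close> consists of erasures and \<open>y\<close>
        adds one more.\<close>
      case False
      with y assms have "y = e"
        by (simp add: state_at_def)
      with False us zs show ?thesis
        by (intro image_eqI[where x = "[]"]) auto
    qed
  qed
qed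

lemma error_prob_dying_ge:
  fixes p_a p_d :: "'x::finite \<Rightarrow> 'y::finite pmf"
  assumes dead: "\<And>x. p_d x = return_pmf e"
    and code: "block_code n M enc dec"
  shows "pmf p_T t * (1 - real (card {us :: 'y list. length us \<le> t}) / real M)
    \<le> error_prob (dying_block_channel p_a p_d p_T) M enc dec"
proof -
  let ?U = "{us :: 'y list. length us \<le> t}"
  let ?q = "\<lambda>m. outputs_given p_a p_d t 1 (enc m)"
  let ?S = "(\<lambda>us. us @ replicate (n - length us) e) ` ?U"
  have "M > 0" and len: "\<And>m. m < M \<Longrightarrow> length (enc m) = n"
    using code by (auto simp: block_code_def)
  have "finite ?U"
    using finite_lists_length_le[of "UNIV :: 'y set" t] by simp
  have "(\<Sum>m<M. measure_pmf.prob (?q m) {ys. dec ys = m}) \<le> real (card ?S)"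
  proof (rule sum_prob_decode_le_card)
    show "set_pmf (?q m) \<subseteq> ?S" if "m < M" for m
      using set_pmf_outputs_given[of p_d e p_a t 1 "enc m", OF dead] len[OF that] by simp
  qed (use \<open>finite ?U\<close> in simp)
  also have "\<dots> \<le> real (card ?U)"
    using \<open>finite ?U\<close> by (simp add: card_image_le)
  finally have success: "(\<Sum>m<M. measure_pmf.prob (?q m) {ys. dec ys = m}) \<le> real (card ?U)" .
  have compl: "measure_pmf.prob (?q m) {ys. dec ys \<noteq> m}
      = 1 - measure_pmf.prob (?q m) {ys. dec ys = m}" for m
    using measure_pmf.prob_compl[of "{ys. dec ys = m}" "?q m"] by (simp add: set_diff_eq)
  \<comment> \<open>Over all messages, the success and error probabilities given \<open>t\<close>
    add up to \<open>M\<close>.\<close>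
  have "pmf p_T t * (real M - real (card ?U))
      \<le> pmf p_T t * (\<Sum>m<M. measure_pmf.prob (?q m) {ys. dec ys \<noteq> m})"
    using success by (intro mult_left_mono) (simp_all add: compl sum_subtractf del: One_nat_def)
  also have "\<dots> \<le> (\<Sum>m<M. measure_pmf.prob (dying_block_channel p_a p_d p_T (enc m)) {ys. dec ys \<noteq> m})"
    unfolding sum_distrib_left dying_block_channel_def
    by (intro sum_mono prob_bind_pmf_ge)
  finally have "pmf p_T t * (real M - real (card ?U)) / real M
      \<le> error_prob (dying_block_channel p_a p_d p_T) M enc dec"
    unfolding error_prob_def by (rule divide_right_mono) simp
  then show ?thesis
    using \<open>M > 0\<close> by (simp add: diff_divide_distrib right_diff_distrib)
qed

lemma not_achievable_rate_dying:
  fixes p_a p_d :: "'x::finite \<Rightarrow> 'y::finite pmf"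
  assumes dead: "\<And>x. p_d x = return_pmf e" and "R > 0"
  shows "\<not> achievable_rate (dying_block_channel p_a p_d p_T) R"
proof
  assume "achievable_rate (dying_block_channel p_a p_d p_T) R"
  then obtain M enc dec where code: "\<And>n. block_code n (M n) (enc n) (dec n)"
    and rate: "\<And>n. real (M n) \<ge> 2 powr (real n * R)"
    and err: "(\<lambda>n. error_prob (dying_block_channel p_a p_d p_T) (M n) (enc n) (dec n)) \<longlonglongrightarrow> 0"
    unfolding achievable_rate_def by blast
  \<comment> \<open>One such \<open>t\<close> serves all block lengths, which makes \<open>K\<close>
    below a constant.\<close>
  obtain t where t: "t \<in> set_pmf p_T"
    using set_pmf_not_empty[of p_T] by blast
  define K where "K = real (card {us :: 'y list. length us \<le> t})"
  have "filterlim (\<lambda>n. 2 powr (real n * R)) at_top sequentially"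
    using \<open>R > 0\<close> by real_asymp
  then have "filterlim (\<lambda>n. real (M n)) at_top sequentially"
    by (rule filterlim_at_top_mono) (simp add: rate)
  then have "(\<lambda>n. K / real (M n)) \<longlonglongrightarrow> 0"
    by (intro tendsto_divide_0[OF tendsto_const] filterlim_at_top_imp_at_infinity)
  then have "(\<lambda>n. pmf p_T t * (1 - K / real (M n))) \<longlonglongrightarrow> pmf p_T t * (1 - 0)"
    by (intro tendsto_intros)
  \<comment> \<open>The lower bounds on the error tend to \<open>pmf p_T t\<close>, while the errors
    themselves tend to 0.\<close>
  then have "pmf p_T t * (1 - 0) \<le> 0"
    using err
    by (rule LIMSEQ_le) (use error_prob_dying_ge[of p_d e, OF dead code] in \<open>auto simp: K_def\<close>)
  with t show False
    by (simp add: set_pmf_iff)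
qed

text \<open>A single message is never decoded wrongly by a constant decoder, whatever letters are
  sent. This keeps the set of rates nonempty; the supremum of the empty set in \<open>ereal\<close>
  would be minus infinity.\<close>

lemma achievable_rate_0: "achievable_rate W 0"
  unfolding achievable_rate_def block_code_def error_prob_def
  by (rule exI[where x = "\<lambda>_. 1"], rule exI[where x = "\<lambda>n _. replicate n undefined"],
      rule exI[where x = "\<lambda>_ _. 0"]) simp

theorem proposition5:
  fixes p_a p_d :: "'x::finite \<Rightarrow> 'y::finite pmf"
    and p_T :: "nat pmf"
    and erasure :: 'y
  assumes "channel_that_dies p_a p_d p_T erasure"
  shows "shannon_capacity (dying_block_channel p_a p_d p_T) = 0"
proof -
  have "p_d x = return_pmf erasure" for x
    using assms by (simp add: channel_that_dies_def)
  then have "{R. R \<ge> 0 \<and> achievable_rate (dying_block_channel p_a p_d p_T) R} = {0}"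
    using not_achievable_rate_dying[of p_d erasure _ p_a p_T] achievable_rate_0
    by (auto simp: order_le_less)
  then show ?thesis
    by (simp add: shannon_capacity_def zero_ereal_def)
qed

end
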